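(* Let $g_1,\dots,g_s\in\mathbb{R}[x_1,\dots,x_n]$, and for $k\in\mathbb{N}$ and $a\le b$ in $\mathbb{R}^n$ let $M^{(k)}_{ab}$ be the associated modified degree-$k$ bounded quadratic module. If $\gamma,\alpha,\beta,\delta\in\mathbb{R}^n$ satisfy $\gamma\le\alpha<\beta\le\delta$ (componentwise, i.e. $\gamma_j\le\alpha_j<\beta_j\le\delta_j$ for every $j$), then $M^{(k)}_{\gamma\delta}\subset M^{(k)}_{\alpha\beta}$ for all $k\ge 2$.
   Context: Let $\Sigma_S$ be the set of polynomials in $\mathbb{R}[x_1,\dots,x_n]$ that are finite sums of squares of polynomials. Set $g_0:=1$. For $a\le b$ in $\mathbb{R}^n$, put $w_j(x):=(b_j-x_j)(x_j-a_j)$, $j=1,\dots,n$. The modified degree-$k$ bounded quadratic module associated to $g_1,\dots,g_s$ is $$M^{(k)}_{ab}:=\Big\{\sum_{i=0}^s\sigma_i g_i+\sum_{j=1}^n\omega_j w_j \;:\; \sigma_i,\omega_j\in\Sigma_S,\ \deg(\sigma_i g_i)\le k,\ \deg(\omega_j w_j)\le k\Big\}$$ (zero multipliers are always allowed). *)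

theory Defs
  imports "HOL-Analysis.Analysis" "HOL-Library.Poly_Mapping"
begin

text \<open>
  The index type \<open>'n\<close> plays the role of \<open>{1, \<dots>, n}\<close>. A polynomial in \<open>\<real>[x\<^sub>1, \<dots>, x\<^sub>n]\<close> is a
  finitely supported map from monomials (finitely supported exponent vectors) to coefficients; its
  ring structure is that of \<^theory>\<open>HOL-Library.Poly_Mapping\<close>, where multiplication is convolution.
\<close>

type_synonym 'n mpoly = "('n \<Rightarrow>\<^sub>0 nat) \<Rightarrow>\<^sub>0 real"

definition Const :: "real \<Rightarrow> 'n mpoly" where
  "Const c = Poly_Mapping.single 0 c"

definition Var :: "'n \<Rightarrow> 'n mpoly" where
  "Var j = Poly_Mapping.single (Poly_Mapping.single j 1) 1"

definition monom_degree :: "('n::finite \<Rightarrow>\<^sub>0 nat) \<Rightarrow> nat" where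
  "monom_degree m = (\<Sum>j\<in>UNIV. Poly_Mapping.lookup m j)"

text \<open>
  The zero polynomial gets degree \<open>0\<close>. Degrees are only ever bounded above by a natural number, so
  this gives the same truncated modules as the convention \<open>deg 0 = -\<infinity>\<close>.
\<close>

definition total_degree :: "'n::finite mpoly \<Rightarrow> nat" where
  "total_degree p = Max (insert 0 (monom_degree ` Poly_Mapping.keys p))"

definition sums_of_squares :: "'n::finite mpoly set" where
  "sums_of_squares = {\<Sum>i<m. q i ^ 2 | (m::nat) (q :: nat \<Rightarrow> 'n mpoly). True}"

definition box_poly :: "real ^ 'n \<Rightarrow> real ^ 'n \<Rightarrow> 'n::finite \<Rightarrow> 'n mpoly" where
  "box_poly a b j = (Const (b $ j) - Var j) * (Var j - Const (a $ j))"

text \<open>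
  The given constraint polynomials are \<open>g 1, \<dots>, g s\<close>. The update \<open>g(0 := 1)\<close> imposes the convention
  \<open>g\<^sub>0 = 1\<close>; the values of \<open>g\<close> at \<open>0\<close> and beyond \<open>s\<close> are irrelevant.
\<close>

definition bounded_quadratic_module ::
  "nat \<Rightarrow> (nat \<Rightarrow> 'n mpoly) \<Rightarrow> nat \<Rightarrow> real ^ 'n \<Rightarrow> real ^ 'n \<Rightarrow> 'n::finite mpoly set" where
  "bounded_quadratic_module s g k a b =
     {(\<Sum>i=0..s. \<sigma> i * (g(0 := 1)) i) + (\<Sum>j\<in>UNIV. \<omega> j * box_poly a b j) | \<sigma> \<omega>.
        (\<forall>i\<le>s. \<sigma> i \<in> sums_of_squares \<and> total_degree (\<sigma> i * (g(0 := 1)) i) \<le> k) \<and>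
        (\<forall>j. \<omega> j \<in> sums_of_squares \<and> total_degree (\<omega> j * box_poly a b j) \<le> k)}"

end

theory Submission
  imports Defs
begin

text \<open>
  The theorem rests on an identity in one variable. Put \<open>u = x - \<alpha>\<close>, \<open>v = \<beta> - x\<close>,
  \<open>L = \<alpha> - \<gamma> \<ge> 0\<close>, \<open>R = \<delta> - \<beta> \<ge> 0\<close> and \<open>d = \<beta> - \<alpha> > 0\<close>, so that \<open>u + v = d\<close>. Multiplying a
  linear form by \<open>(u + v) / d = 1\<close> gives \<open>u = (u\<^sup>2 + u v) / d\<close> and \<open>v = (v\<^sup>2 + u v) / d\<close>, hence

    \<open>(\<delta> - x) (x - \<gamma>) = (R + v) (L + u) = (1 + (L + R) / d) u v + R L + (R / d) u\<^sup>2 + (L / d) v\<^sup>2\<close>.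

  The polynomial of the larger interval is therefore a positive multiple of that of the smaller
  one, plus a sum of squares of degree at most two. In an element of the module of the larger
  box, each term \<open>\<omega>\<^sub>j w\<^sub>j\<close> splits accordingly: a positive multiple of \<open>\<omega>\<^sub>j\<close> becomes the new
  multiplier of the smaller box, and \<open>\<omega>\<^sub>j\<close> times the sum of squares is absorbed into \<open>\<sigma>\<^sub>0\<close>
  (lemma \<open>box_poly_enlarge\<close>).

  The degree bounds survive because multiplication by \<open>w\<^sub>j\<close> raises the degree of a nonzero
  polynomial by two, there being no cancellation in top degree
  (lemma \<open>total_degree_times_box_poly_ge\<close>). Hence a nonzero \<open>\<omega>\<^sub>j\<close> with \<open>deg (\<omega>\<^sub>j w\<^sub>j) \<le> k\<close> has
  degree at most \<open>k - 2\<close>, and its product with any polynomial of degree at most two has degree at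
  most \<open>k\<close>.
\<close>

section \<open>Total degree\<close>

lemma total_degree_le_iff:
  "total_degree p \<le> k \<longleftrightarrow> (\<forall>m\<in>Poly_Mapping.keys p. monom_degree m \<le> k)"
  by (simp add: total_degree_def)

lemma monom_degree_le_total_degree:
  "m \<in> Poly_Mapping.keys p \<Longrightarrow> monom_degree m \<le> total_degree p"
  using total_degree_le_iff by blast

lemma monom_degree_add: "monom_degree (m + n) = monom_degree m + monom_degree n"
  by (simp add: monom_degree_def lookup_add sum.distrib)

lemma monom_degree_single: "monom_degree (Poly_Mapping.single j e) = e"
  by (simp add: monom_degree_def lookup_single when_def)

lemma total_degree_add_le:
  "total_degree p \<le> k \<Longrightarrow> total_degree q \<le> k \<Longrightarrow> total_degree (p + q) \<le> k"
  using keys_add[of p q] by (auto simp: total_degree_le_iff)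

lemma total_degree_diff_le:
  "total_degree p \<le> k \<Longrightarrow> total_degree q \<le> k \<Longrightarrow> total_degree (p - q) \<le> k"
  using keys_diff[of p q] by (auto simp: total_degree_le_iff)

lemma total_degree_zero: "total_degree 0 = 0"
  by (simp add: total_degree_def)

lemma total_degree_sum_le:
  "(\<And>i. i \<in> A \<Longrightarrow> total_degree (p i) \<le> k) \<Longrightarrow> total_degree (sum p A) \<le> k"
  by (induction A rule: infinite_finite_induct) (auto simp: total_degree_zero total_degree_add_le)

lemma total_degree_mult_le: "total_degree (p * q) \<le> total_degree p + total_degree q"
  unfolding total_degree_le_iff
proof
  fix m assume "m \<in> Poly_Mapping.keys (p * q)"
  then obtain a b where "m = a + b" "a \<in> Poly_Mapping.keys p" "b \<in> Poly_Mapping.keys q"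
    using keys_mult[of p q] by blast
  then show "monom_degree m \<le> total_degree p + total_degree q"
    by (simp add: monom_degree_add add_mono monom_degree_le_total_degree)
qed

lemma total_degree_Const: "total_degree (Const c) = 0"
  by (simp add: total_degree_def Const_def monom_degree_def)

lemma total_degree_Var_le: "total_degree (Var j) \<le> 1"
  by (simp add: total_degree_le_iff Var_def monom_degree_single)

lemma total_degree_square_le: "total_degree p \<le> 1 \<Longrightarrow> total_degree (p ^ 2) \<le> 2"
  using total_degree_mult_le[of p p] by (simp add: power2_eq_square)

lemma total_degree_Var_diff_Const_le: "total_degree (Var j - Const c) \<le> 1"
  and total_degree_Const_diff_Var_le: "total_degree (Const c - Var j) \<le> 1"
  by (auto intro!: total_degree_diff_le simp: total_degree_Const total_degree_Var_le[simplified])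

lemma total_degree_box_poly_le: "total_degree (box_poly a b j) \<le> 2"
  using total_degree_mult_le[of "Const (b $ j) - Var j" "Var j - Const (a $ j)"]
    total_degree_Var_diff_Const_le[of j "a $ j"] total_degree_Const_diff_Var_le[of "b $ j" j]
  by (simp add: box_poly_def)

lemma lookup_single_times:
  fixes p :: "'n mpoly"
  shows "Poly_Mapping.lookup (Poly_Mapping.single t c * p) (t + m) = c * Poly_Mapping.lookup p m"
  by (simp add: lookup_mult lookup_single when_mult)

lemma box_poly_expand:
  fixes a b :: "real ^ 'a::finite"
  shows "box_poly a b j =
     Poly_Mapping.single (Poly_Mapping.single j 2) (-1)
     + Poly_Mapping.single (Poly_Mapping.single j 1) (a $ j + b $ j)
     + Poly_Mapping.single 0 (- (a $ j * b $ j))"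
proof -
  have "Poly_Mapping.single (Poly_Mapping.single j 2) (-1) = - (Var j * Var j :: 'a mpoly)"
    by (simp add: Var_def mult_single single_uminus numeral_2_eq_2 flip: single_add)
  moreover have "Poly_Mapping.single (Poly_Mapping.single j 1) (a $ j + b $ j)
      = Const (a $ j) * Var j + Const (b $ j) * Var j"
    by (simp add: Var_def Const_def mult_single single_add)
  moreover have "Poly_Mapping.single 0 (- (a $ j * b $ j)) =
      - (Const (a $ j) * Const (b $ j) :: 'a mpoly)"
    by (simp add: Const_def mult_single single_uminus)
  ultimately show ?thesis
    by (simp add: box_poly_def algebra_simps)
qed

text \<open>
  If \<open>m\<close> is a monomial of top degree in \<open>p\<close>, then the coefficient of \<open>m x\<^sub>j\<^sup>2\<close> in the product is
  minus the coefficient of \<open>m\<close> in \<open>p\<close>: the lower terms of the quadratic could only reach \<open>m x\<^sub>j\<^sup>2\<close>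
  from monomials of \<open>p\<close> of larger degree.
\<close>

lemma total_degree_times_box_poly_ge:
  assumes "p \<noteq> 0"
  shows "total_degree p + 2 \<le> total_degree (p * box_poly a b j)"
proof -
  let ?e = "Poly_Mapping.single j (1::nat)" and ?e2 = "Poly_Mapping.single j (2::nat)"
  have "Poly_Mapping.keys p \<noteq> {}"
    using assms by simp
  then obtain m where m: "m \<in> Poly_Mapping.keys p" "monom_degree m = total_degree p"
    unfolding total_degree_def
    by (metis (no_types, lifting) Max_in Max_insert finite_imageI finite_keys image_iff
        image_is_empty max_0L)
  have above: "Poly_Mapping.lookup p (t + m) = 0" if "monom_degree t > 0" for t
    using monom_degree_le_total_degree[of "t + m" p] that m(2)
    by (auto simp: monom_degree_add in_keys_iff)
  have e2: "?e2 = ?e + ?e"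
    by (simp add: numeral_2_eq_2 flip: single_add)
  have "Poly_Mapping.lookup (p * box_poly a b j) (?e2 + m) =
      - Poly_Mapping.lookup p m
      + (a $ j + b $ j) * Poly_Mapping.lookup p (?e + m)
      - a $ j * b $ j * Poly_Mapping.lookup p (?e2 + m)"
    using lookup_single_times[of ?e2 "-1" p m]
      lookup_single_times[of ?e "a $ j + b $ j" p "?e + m"]
      lookup_single_times[of 0 "- (a $ j * b $ j)" p "?e2 + m"]
    unfolding box_poly_expand mult.commute[of p] distrib_right lookup_add
    by (simp add: e2 add.assoc)
  then have "?e2 + m \<in> Poly_Mapping.keys (p * box_poly a b j)"
    using m(1) by (simp add: above monom_degree_single in_keys_iff)
  from monom_degree_le_total_degree[OF this] show ?thesis
    by (simp add: monom_degree_add monom_degree_single m(2))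
qed

text \<open>
  Both new multiples of \<open>\<omega>\<close>, by the quadratic of the smaller box and by the remainder, stay within
  the degree bound for this reason.
\<close>

lemma total_degree_times_le_if_box_poly:
  assumes "total_degree (\<omega> * box_poly a b j) \<le> k" and "total_degree q \<le> 2"
  shows "total_degree (\<omega> * q) \<le> k"
proof (cases "\<omega> = 0")
  case False
  then show ?thesis
    using total_degree_times_box_poly_ge[of \<omega> a b j] total_degree_mult_le[of \<omega> q] assms by simp
qed (simp add: total_degree_zero)

section \<open>Sums of squares\<close>

lemma sums_of_squaresI:
  fixes q :: "nat \<Rightarrow> 'n::finite mpoly"
  shows "(\<Sum>i<m. q i ^ 2) \<in> sums_of_squares"
  unfolding sums_of_squares_def by blast

lemma sums_of_squares_zero: "0 \<in> sums_of_squares"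
  using sums_of_squaresI[of "\<lambda>_. 0" 0] by simp

lemma sums_of_squares_add:
  assumes "p \<in> sums_of_squares" and "r \<in> sums_of_squares"
  shows "p + r \<in> sums_of_squares"
proof -
  obtain m n :: nat and q q' where p: "p = (\<Sum>i<m. q i ^ 2)" and r: "r = (\<Sum>i<n. q' i ^ 2)"
    using assms by (auto simp: sums_of_squares_def)
  have "(\<Sum>i<m + n. (if i < m then q i else q' (i - m)) ^ 2) =
      (\<Sum>i<m. q i ^ 2) + (\<Sum>i<n. q' i ^ 2)"
    by (induction n) (simp_all add: add.assoc)
  from sums_of_squaresI[of "\<lambda>i. if i < m then q i else q' (i - m)" "m + n", unfolded this]
  show ?thesis
    by (simp only: p r)
qed

lemma sums_of_squares_sum:
  "(\<And>i. i \<in> A \<Longrightarrow> p i \<in> sums_of_squares) \<Longrightarrow> sum p A \<in> sums_of_squares"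
  by (induction A rule: infinite_finite_induct)
    (auto simp: sums_of_squares_zero sums_of_squares_add)

lemma sums_of_squares_times_square:
  assumes "p \<in> sums_of_squares"
  shows "p * r ^ 2 \<in> sums_of_squares"
proof -
  obtain m :: nat and q where "p = (\<Sum>i<m. q i ^ 2)"
    using assms by (auto simp: sums_of_squares_def)
  then have "p * r ^ 2 = (\<Sum>i<m. (q i * r) ^ 2)"
    by (simp add: sum_distrib_right power_mult_distrib)
  then show ?thesis
    by (simp only: sums_of_squaresI)
qed

lemma Const_add: "Const (a + b) = Const a + Const b"
  and Const_diff: "Const (a - b) = Const a - Const b"
  and Const_mult: "Const (a * b) = Const a * Const b"
  and Const_one: "Const 1 = 1"
  by (simp_all add: Const_def single_add single_diff mult_single)

lemma sums_of_squares_times_Const: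
  assumes "p \<in> sums_of_squares" and "c \<ge> 0"
  shows "p * Const c \<in> sums_of_squares"
proof -
  have "Const c = Const (sqrt c) ^ 2"
    using assms(2) by (simp add: power2_eq_square flip: Const_mult)
  then show ?thesis
    using sums_of_squares_times_square[OF assms(1)] by metis
qed

section \<open>Comparing the polynomials of nested boxes\<close>

text \<open>
  The remainder is \<open>q = R L + (R / d) u\<^sup>2 + (L / d) v\<^sup>2\<close>, a combination of squares with
  nonnegative coefficients. Each product \<open>\<omega> q\<close> with a sum of squares \<open>\<omega>\<close> is therefore a sum of
  squares, which is the form in which \<open>q\<close> enters \<open>\<sigma>\<^sub>0\<close>.
\<close>

lemma box_poly_enlarge:
  fixes a b a' b' :: "real ^ 'n::finite"
  assumes "a' $ j \<le> a $ j" "a $ j < b $ j" "b $ j \<le> b' $ j"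
  obtains c q where "c \<ge> 0" "total_degree q \<le> 2"
    "box_poly a' b' j = Const c * box_poly a b j + q"
    "\<And>\<omega>. \<omega> \<in> sums_of_squares \<Longrightarrow> \<omega> * q \<in> sums_of_squares"
proof -
  define d L R where "d = b $ j - a $ j" and "L = a $ j - a' $ j" and "R = b' $ j - b $ j"
  define e where "e = 1 / d"
  have pos: "d > 0" "L \<ge> 0" "R \<ge> 0" "e > 0"
    using assms by (auto simp: d_def L_def R_def e_def)
  define u v :: "'n mpoly" where "u = Var j - Const (a $ j)" and "v = Const (b $ j) - Var j"
  define q where "q = Const (R * L) + u ^ 2 * Const (R * e) + v ^ 2 * Const (L * e)"
  have "u + v = Const d"
    by (simp add: u_def v_def d_def Const_diff)
  then have unit: "Const e * (u + v) = 1"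
    using pos by (simp add: e_def Const_one flip: Const_mult)
  have "Const (b' $ j) - Var j = Const R + v" "Var j - Const (a' $ j) = Const L + u"
    by (simp_all add: u_def v_def L_def R_def Const_diff)
  then have "box_poly a' b' j = v * u + Const (R * L) + Const R * u + Const L * v"
    by (simp add: box_poly_def Const_mult algebra_simps)
  \<comment> \<open>Homogenising the linear terms with \<open>(u + v) / d = 1\<close> turns them into \<open>u\<^sup>2\<close>, \<open>v\<^sup>2\<close> and \<open>u v\<close>.\<close>
  also have "\<dots> = v * u + Const (R * L) + Const R * u * (Const e * (u + v))
      + Const L * v * (Const e * (u + v))"
    by (simp only: unit mult_1_right)
  also have "\<dots> = Const (1 + (R + L) * e) * (v * u) + q"
    by (simp add: q_def Const_add Const_mult Const_one power2_eq_square algebra_simps)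
  finally have "box_poly a' b' j = Const (1 + (R + L) * e) * box_poly a b j + q"
    by (simp add: u_def v_def box_poly_def)
  moreover have "total_degree (r ^ 2 * Const c) \<le> 2" if "total_degree r \<le> 1" for r :: "'n mpoly" and c
    using total_degree_mult_le[of "r ^ 2" "Const c"] total_degree_square_le[OF that]
    by (simp add: total_degree_Const)
  then have "total_degree q \<le> 2"
    unfolding q_def u_def v_def
    by (intro total_degree_add_le)
      (auto simp: total_degree_Const total_degree_Var_diff_Const_le[simplified]
        total_degree_Const_diff_Var_le[simplified])
  moreover have "\<omega> * q \<in> sums_of_squares" if "\<omega> \<in> sums_of_squares" for \<omega>
    unfolding q_def distrib_left mult.assoc[symmetric]
    using pos that
    by (intro sums_of_squares_add sums_of_squares_times_Const sums_of_squares_times_square) auto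
  moreover have "1 + (R + L) * e \<ge> 0"
    using pos by simp
  ultimately show thesis
    using that by blast
qed

theorem lemma2:
  fixes s k :: nat
    and g :: "nat \<Rightarrow> 'n::finite mpoly"
    and \<gamma> \<alpha> \<beta> \<delta> :: "real ^ 'n"
  assumes "\<forall>j. \<gamma> $ j \<le> \<alpha> $ j \<and> \<alpha> $ j < \<beta> $ j \<and> \<beta> $ j \<le> \<delta> $ j"
    and "k \<ge> 2"
  shows "bounded_quadratic_module s g k \<gamma> \<delta> \<subseteq> bounded_quadratic_module s g k \<alpha> \<beta>"
proof
  fix f assume "f \<in> bounded_quadratic_module s g k \<gamma> \<delta>"
  then obtain \<sigma> \<omega> where
    f: "f = (\<Sum>i=0..s. \<sigma> i * (g(0 := 1)) i) + (\<Sum>j\<in>UNIV. \<omega> j * box_poly \<gamma> \<delta> j)"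
    and \<sigma>: "\<And>i. i \<le> s \<Longrightarrow> \<sigma> i \<in> sums_of_squares"
      "\<And>i. i \<le> s \<Longrightarrow> total_degree (\<sigma> i * (g(0 := 1)) i) \<le> k"
    and \<omega>: "\<And>j. \<omega> j \<in> sums_of_squares" "\<And>j. total_degree (\<omega> j * box_poly \<gamma> \<delta> j) \<le> k"
    unfolding bounded_quadratic_module_def by blast
  have "\<forall>j. \<exists>c q. c \<ge> 0 \<and> total_degree q \<le> 2 \<and>
      box_poly \<gamma> \<delta> j = Const c * box_poly \<alpha> \<beta> j + q \<and>
      (\<forall>p\<in>sums_of_squares. p * q \<in> sums_of_squares)"
    using assms(1) box_poly_enlarge by metis
  then obtain c q where c: "\<And>j. c j \<ge> 0" and q: "\<And>j. total_degree (q j) \<le> 2"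
    and split: "\<And>j. box_poly \<gamma> \<delta> j = Const (c j) * box_poly \<alpha> \<beta> j + q j"
    and sos: "\<And>j p. p \<in> sums_of_squares \<Longrightarrow> p * q j \<in> sums_of_squares"
    by metis
  define \<rho> where "\<rho> = (\<Sum>j\<in>UNIV. \<omega> j * q j)"
  define \<sigma>' where "\<sigma>' = \<sigma>(0 := \<sigma> 0 + \<rho>)"
  define \<omega>' where "\<omega>' j = \<omega> j * Const (c j)" for j
  have \<rho>: "\<rho> \<in> sums_of_squares" "total_degree \<rho> \<le> k"
    unfolding \<rho>_def
    by (auto intro!: sums_of_squares_sum sos \<omega> total_degree_sum_le
        total_degree_times_le_if_box_poly[OF \<omega>(2) q])
  have "(\<Sum>i=0..s. \<sigma>' i * (g(0 := 1)) i) = (\<Sum>i=0..s. \<sigma> i * (g(0 := 1)) i) + \<rho>"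
    by (simp add: \<sigma>'_def sum.atLeast_Suc_atMost[of 0 s])
  moreover have "(\<Sum>j\<in>UNIV. \<omega> j * box_poly \<gamma> \<delta> j) = (\<Sum>j\<in>UNIV. \<omega>' j * box_poly \<alpha> \<beta> j) + \<rho>"
    by (simp add: \<rho>_def \<omega>'_def split algebra_simps sum.distrib)
  ultimately have "f = (\<Sum>i=0..s. \<sigma>' i * (g(0 := 1)) i) + (\<Sum>j\<in>UNIV. \<omega>' j * box_poly \<alpha> \<beta> j)"
    by (simp add: f add_ac)
  moreover have "\<sigma>' i \<in> sums_of_squares \<and> total_degree (\<sigma>' i * (g(0 := 1)) i) \<le> k"
    if "i \<le> s" for i
    using \<sigma>[OF that] \<rho> by (auto simp: \<sigma>'_def sums_of_squares_add total_degree_add_le)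
  moreover have "\<omega>' j \<in> sums_of_squares \<and> total_degree (\<omega>' j * box_poly \<alpha> \<beta> j) \<le> k" for j
  proof
    show "\<omega>' j \<in> sums_of_squares"
      by (simp add: \<omega>'_def sums_of_squares_times_Const \<omega> c)
    have "total_degree (Const (c j) * box_poly \<alpha> \<beta> j) \<le> 2"
      using total_degree_mult_le[of "Const (c j)" "box_poly \<alpha> \<beta> j"] total_degree_box_poly_le[of \<alpha> \<beta> j]
      by (simp add: total_degree_Const)
    from total_degree_times_le_if_box_poly[OF \<omega>(2) this]
    show "total_degree (\<omega>' j * box_poly \<alpha> \<beta> j) \<le> k"
      by (simp add: \<omega>'_def mult.assoc)
  qed
  ultimately show "f \<in> bounded_quadratic_module s g k \<alpha> \<beta>"
    unfolding bounded_quadratic_module_def by blast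
qed

end
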